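(* Let $R$ be an aperiodic two-step rule, take $x,y\in(0,\infty)$, let $\theta$ be one of the four step directions, and let $F_\theta(t;x,y)$ be the corresponding full-plane generating function. Let $\rho_\theta(x,y)$ be the smallest positive value of $t$ which solves $B_\theta(t;x,y)=1$, and define $\mu_\theta(x,y)=1/\rho_\theta(x,y)$. Then, with $\Theta_m(x,y)$ standing for the coefficient of $t^m$ in $F_\theta(t;x,y)$, $$\Theta_m(x,y)\sim\mu_\theta(x,y)\cdot\frac{A_\theta(\rho_\theta(x,y);x,y)}{B_\theta^{(1,0,0)}(\rho_\theta(x,y);x,y)}\cdot\mu_\theta(x,y)^m\qquad\text{as }m\to\infty.$$
   Context: Steps on $\mathbb Z^2$: east $(1,0)$, north $(0,1)$, west $(-1,0)$, south $(0,-1)$, abbreviated $e,n,w,s$. A two-step rule is a map $R:\{e,n,w,s\}^2\to\{0,1\}$; $R(i,j)=1$ means a step of type $i$ may be immediately followed by one of type $j$. Its transfer matrix is $T=(R(i,j))_{i,j}$. The rule is aperiodic if there is $k\ge1$ with $(T^k)_{ij}>0$ for all $i,j$. A walk obeying $R$ is a nonempty finite sequence of steps, starting at the origin, with arbitrary first step and with $R(i,j)=1$ for each consecutive pair $(i,j)$. The generating function of a class of walks is $\sum t^m x^a y^b$ over walks in the class, where $m$ is the length and $(a,b)$ the endpoint. $F_\theta(t;x,y)$: all walks obeying $R$ (in the full plane) whose last step is $\theta$. $A_\theta(t;x,y)$: walks obeying $R$, with any first step, containing exactly one $\theta$ step, which is their last step. $B_\theta(t;x,y)$: walks obeying $R$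 whose first step $j$ satisfies $R(\theta,j)=1$, containing exactly one $\theta$ step, which is their last step. These are (expansions of) rational functions. $B_\theta^{(i,j,k)}$ denotes the partial derivative taken $i$ times in $t$, $j$ times in $x$ and $k$ times in $y$. $\rho_\theta(x,y)$ is well defined for $x,y\in(0,\infty)$. *)

theory Defs
  imports "HOL-Analysis.Analysis" "HOL-Library.Landau_Symbols"
begin

datatype step = East | North | West | South

instance step :: finite
proof
  have "(UNIV :: step set) = {East, North, West, South}"
    using step.exhaust by blast
  then show "finite (UNIV :: step set)"
    by (metis finite.emptyI finite.insertI)
qed

fun step_vec :: "step \<Rightarrow> int \<times> int" where
  "step_vec East = (1, 0)"
| "step_vec North = (0, 1)"
| "step_vec West = (-1, 0)"
| "step_vec South = (0, -1)"

type_synonym two_step_rule = "step \<Rightarrow> step \<Rightarrow> bool"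

definition transfer_matrix :: "two_step_rule \<Rightarrow> real ^ step ^ step" where
  "transfer_matrix R = (\<chi> i j. of_bool (R i j))"

(* The power T ^ k on type vec would be taken entrywise; this is the power for the matrix product. *)
definition matrix_power :: "'a::semiring_1 ^ 'n ^ 'n \<Rightarrow> nat \<Rightarrow> 'a ^ 'n ^ 'n" where
  "matrix_power T k = ((\<lambda>M. T ** M) ^^ k) (mat 1)"

definition aperiodic_rule :: "two_step_rule \<Rightarrow> bool" where
  "aperiodic_rule R \<longleftrightarrow>
     (\<exists>k\<ge>1. \<forall>i j. matrix_power (transfer_matrix R) k $ i $ j > 0)"

definition walk :: "two_step_rule \<Rightarrow> step list \<Rightarrow> bool" where
  "walk R w \<longleftrightarrow> w \<noteq> [] \<and> successively R w"

definition endpoint :: "step list \<Rightarrow> int \<times> int" where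
  "endpoint w = sum_list (map step_vec w)"

(* The generating function at fixed numerical x, y, as a formal power series in t.
   There are finitely many walks of each length, so the inner sums are finite. *)
definition walk_gf :: "step list set \<Rightarrow> real \<Rightarrow> real \<Rightarrow> real fps" where
  "walk_gf C x y =
     Abs_fps (\<lambda>m. \<Sum>w | w \<in> C \<and> length w = m.
                     x powi fst (endpoint w) * y powi snd (endpoint w))"

definition F_gf :: "two_step_rule \<Rightarrow> step \<Rightarrow> real \<Rightarrow> real \<Rightarrow> real fps" where
  "F_gf R \<theta> = walk_gf {w. walk R w \<and> last w = \<theta>}"

definition A_gf :: "two_step_rule \<Rightarrow> step \<Rightarrow> real \<Rightarrow> real \<Rightarrow> real fps" where
  "A_gf R \<theta> = walk_gf {w. walk R w \<and> count_list w \<theta> = 1 \<and> last w = \<theta>}"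

definition B_gf :: "two_step_rule \<Rightarrow> step \<Rightarrow> real \<Rightarrow> real \<Rightarrow> real fps" where
  "B_gf R \<theta> =
     walk_gf {w. walk R w \<and> R \<theta> (hd w) \<and> count_list w \<theta> = 1 \<and> last w = \<theta>}"

definition A_fun :: "two_step_rule \<Rightarrow> step \<Rightarrow> real \<Rightarrow> real \<Rightarrow> real \<Rightarrow> real" where
  "A_fun R \<theta> t x y = eval_fps (A_gf R \<theta> x y) t"

definition B_fun :: "two_step_rule \<Rightarrow> step \<Rightarrow> real \<Rightarrow> real \<Rightarrow> real \<Rightarrow> real" where
  "B_fun R \<theta> t x y = eval_fps (B_gf R \<theta> x y) t"

(* eval_fps is meaningful only where the series converges, hence the explicit bound on t.
   It loses no root that matters: B has nonnegative coefficients for x, y > 0, so a rational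
   function with expansion B is either a polynomial or has a pole on the positive axis at the
   radius of convergence; for a nonzero B (B has no constant term) the equation B = 1 thus has
   a positive solution inside the disc of convergence. *)
definition rho :: "two_step_rule \<Rightarrow> step \<Rightarrow> real \<Rightarrow> real \<Rightarrow> real" where
  "rho R \<theta> x y =
     (LEAST t. 0 < t \<and> ereal t < fps_conv_radius (B_gf R \<theta> x y) \<and> B_fun R \<theta> t x y = 1)"

definition mu :: "two_step_rule \<Rightarrow> step \<Rightarrow> real \<Rightarrow> real \<Rightarrow> real" where
  "mu R \<theta> x y = 1 / rho R \<theta> x y"

definition Theta_coeff :: "two_step_rule \<Rightarrow> step \<Rightarrow> nat \<Rightarrow> real \<Rightarrow> real \<Rightarrow> real" where
  "Theta_coeff R \<theta> m x y = fps_nth (F_gf R \<theta> x y) m"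

end

theory Submission
  imports Defs "HOL-Complex_Analysis.Cauchy_Integral_Formula"
begin

text \<open>
  Cutting a walk that ends in \<open>\<theta>\<close> after its last but one \<open>\<theta>\<close> gives \<open>F = A + F B\<close>, so the
  coefficients of \<open>F\<close> solve a renewal equation. If \<open>B \<rho> = 1\<close>, the coefficients of \<open>B\<close>, multiplied by
  \<open>\<rho> ^ n\<close>, form a probability distribution with mean \<open>\<rho> B' \<rho>\<close>, and the renewal theorem
  (\<open>renewal_theorem\<close>) says that the coefficients of \<open>F\<close>, multiplied by \<open>\<rho> ^ m\<close>, converge to
  \<open>A \<rho> / (\<rho> B' \<rho>)\<close>. This is the claim. Three things have to be checked.
  
  The root \<open>\<rho>\<close> exists inside the disc of convergence of \<open>B\<close>, and \<open>A\<close> converges at \<open>\<rho>\<close>. Both follow from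
  the weighted number \<open>S n\<close> of walks of length \<open>n\<close> avoiding \<open>\<theta>\<close>. It is submultiplicative
  (\<open>total_avoiding_submult\<close>) and, because the rule is irreducible, bounded by the coefficients of \<open>B\<close> up
  to shifts and constants (\<open>avoiding_tends_to_0\<close>). If the terms of \<open>B t\<close> tend to zero, then so do the
  numbers \<open>S n * t ^ n\<close>; one of them is below \<open>1\<close>, and by submultiplicativity \<open>S n * s ^ n\<close> is bounded for
  some \<open>s > t\<close>. As \<open>A\<close> and \<open>B\<close> are dominated by \<open>S\<close>, they converge beyond \<open>t\<close>. In particular \<open>B\<close> diverges
  at a finite radius of convergence, so it takes the value \<open>1\<close> before (\<open>eval_fps_eq_1_root\<close>).
  
  The distribution is aperiodic: a complex \<open>z\<close> with \<open>z ^ n = 1\<close> for all return lengths \<open>n\<close> has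
  \<open>z ^ n = 1\<close> for the lengths of all closed walks at \<open>\<theta>\<close>, and an aperiodic rule has closed walks of two
  consecutive lengths (\<open>return_aperiodic\<close>).
  
  The renewal theorem itself is easy here because the distribution has an exponential tail: dividing
  \<open>1 - B\<close> by its simple zero leaves a series without zeros on a disc strictly larger than the critical
  one (\<open>renewal_limit\<close>).
  
  The combinatorial part works for positive weights on the steps of any finite step set. For the plane
  the weight of a step is \<open>x\<close>, \<open>y\<close>, \<open>1 / x\<close> or \<open>1 / y\<close>, and \<open>A\<close>, \<open>B\<close>, \<open>F\<close> are the generating functions
  of the classes \<open>arrival\<close>, \<open>return\<close>, \<open>ending\<close>.
\<close>

section \<open>Power series with nonnegative coefficients and the renewal theorem\<close>

lemma conv_radius_ge_bounded:
  fixes f :: "nat \<Rightarrow> 'a :: {banach, real_normed_div_algebra}"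
  assumes s: "0 < s" and bd: "\<And>n. norm (f n) * s ^ n \<le> K"
  shows "ereal s \<le> conv_radius f"
proof (rule conv_radius_geI_ex')
  fix r :: real assume r: "0 < r" "ereal r < ereal s"
  show "summable (\<lambda>n. f n * of_real r ^ n)"
  proof (rule summable_comparison_test')
    show "summable (\<lambda>n. K * (r / s) ^ n)"
      using r s by (intro summable_mult summable_geometric) auto
    show "norm (f n * of_real r ^ n) \<le> K * (r / s) ^ n" for n
    proof -
      have "norm (f n * of_real r ^ n) = (norm (f n) * s ^ n) * (r / s) ^ n"
        using r s by (simp add: norm_mult norm_power power_divide)
      also have "\<dots> \<le> K * (r / s) ^ n"
        using r s bd[of n] by (intro mult_right_mono) auto
      finally show ?thesis .
    qed
  qed
qed

definition complex_fps :: "real fps \<Rightarrow> complex fps" where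
  "complex_fps f = Abs_fps (\<lambda>n. of_real (fps_nth f n))"

lemma complex_fps_nth [simp]: "fps_nth (complex_fps f) n = of_real (fps_nth f n)"
  by (simp add: complex_fps_def)

lemma complex_fps_mult: "complex_fps (f * g) = complex_fps f * complex_fps g"
  by (simp add: fps_eq_iff fps_mult_nth)

lemma fps_conv_radius_complex_fps [simp]:
  "fps_conv_radius (complex_fps f) = fps_conv_radius f"
proof -
  have "conv_radius (\<lambda>n. complex_of_real (fps_nth f n)) = conv_radius (\<lambda>n. norm (fps_nth f n))"
    by (intro conv_radius_cong) simp
  then show ?thesis unfolding fps_conv_radius_def conv_radius_norm by simp
qed

lemma eval_complex_fps:
  assumes "ereal \<bar>t\<bar> < fps_conv_radius f"
  shows "eval_fps (complex_fps f) (of_real t) = of_real (eval_fps f t)"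
proof -
  have "(\<lambda>n. complex_of_real (fps_nth f n * t ^ n)) sums of_real (eval_fps f t)"
    using assms by (intro sums_of_real sums_eval_fps) simp
  then show ?thesis by (simp add: eval_fps_def sums_iff)
qed

text \<open>
  The renewal theorem for a probability distribution \<open>p\<close> with an exponential tail. The series
  \<open>1 - p\<close> has a zero at \<open>1\<close>; dividing it out gives \<open>1 - p = (1 - X) q\<close>, where the coefficients of \<open>q\<close>
  are the tails of \<open>p\<close> and \<open>q 1 = p' 1\<close> is the mean. The exponential tail makes \<open>q\<close> converge on a disc
  larger than the unit disc, and aperiodicity says that \<open>1\<close> is the only zero of \<open>1 - p\<close> in the closed
  unit disc, so \<open>q\<close> has none. Hence \<open>a / q\<close> also converges on a larger disc. Since
  \<open>u = (a / q) / (1 - X)\<close>, the coefficients of \<open>u\<close> are the partial sums of \<open>a / q\<close> and converge to its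
  value at \<open>1\<close>.
\<close>

lemma renewal_limit:
  fixes a p u :: "real fps"
  assumes p_nonneg: "\<And>n. 0 \<le> fps_nth p n" and p0: "fps_nth p 0 = 0"
    and ra: "1 < fps_conv_radius a" and rp: "1 < fps_conv_radius p"
    and p1: "eval_fps p 1 = 1"
    and aperiodic: "\<And>z::complex. (\<And>n. 0 < fps_nth p n \<Longrightarrow> z ^ n = 1) \<Longrightarrow> z = 1"
    and renewal: "u = a + u * p"
  shows "(\<lambda>m. fps_nth u m) \<longlonglongrightarrow> eval_fps a 1 / eval_fps (fps_deriv p) 1"
    and "0 < eval_fps (fps_deriv p) 1"
proof -
  \<comment> \<open>the tails of the distribution, which are the coefficients of the quotient of 1 - p by 1 - X\<close>
  define q where "q = Abs_fps (\<lambda>n. 1 - (\<Sum>k\<le>n. fps_nth p k))"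
  have p_sums: "(\<lambda>n. fps_nth p n * s ^ n) sums eval_fps p s"
    if "ereal \<bar>s\<bar> < fps_conv_radius p" for s
    using that by (intro sums_eval_fps) simp
  have p_sums1: "fps_nth p sums 1"
    using p_sums[of 1] rp p1 by (simp add: one_ereal_def)
  have q_nonneg: "0 \<le> fps_nth q n" for n
  proof -
    have "(\<Sum>k\<le>n. fps_nth p k) \<le> (\<Sum>k. fps_nth p k)"
      using p_sums1 p_nonneg by (intro sum_le_suminf) (auto simp: sums_iff)
    then show ?thesis using p_sums1 by (simp add: q_def sums_iff)
  qed
  \<comment> \<open>moving the power of s into the tail only increases it, because s is at least 1\<close>
  have q_bound: "fps_nth q n * s ^ n \<le> eval_fps p s"
    if s: "1 \<le> s" "ereal s < fps_conv_radius p" for n s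
  proof -
    have S: "(\<lambda>k. fps_nth p k * s ^ k) sums eval_fps p s" using s by (intro p_sums) auto
    have tail: "(\<lambda>k. fps_nth p (k + Suc n)) sums fps_nth q n"
      using p_sums1 by (subst sums_iff_shift) (simp add: q_def lessThan_Suc_atMost)
    then have "fps_nth q n * s ^ n = (\<Sum>k. fps_nth p (k + Suc n) * s ^ n)"
      by (metis sums_unique sums_mult2)
    also have "\<dots> \<le> (\<Sum>k. fps_nth p (k + Suc n) * s ^ (k + Suc n))"
    proof (rule suminf_le)
      show "fps_nth p (k + Suc n) * s ^ n \<le> fps_nth p (k + Suc n) * s ^ (k + Suc n)" for k
        using s p_nonneg by (intro mult_left_mono power_increasing) auto
      show "summable (\<lambda>k. fps_nth p (k + Suc n) * s ^ n)"
        using tail by (intro summable_mult2) (auto simp: sums_iff)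
      show "summable (\<lambda>k. fps_nth p (k + Suc n) * s ^ (k + Suc n))"
        using S by (subst summable_iff_shift) (auto simp: sums_iff)
    qed
    also have "\<dots> = eval_fps p s - (\<Sum>k<Suc n. fps_nth p k * s ^ k)"
      using S by (subst suminf_minus_initial_segment) (auto simp: sums_iff)
    also have "\<dots> \<le> eval_fps p s"
      using s p_nonneg sum_nonneg[of "{..<Suc n}" "\<lambda>k. fps_nth p k * s ^ k"] by simp
    finally show ?thesis .
  qed
  have rq: "1 < fps_conv_radius q"
  proof -
    obtain s where s: "1 < s" "ereal s < fps_conv_radius p"
      using ereal_dense2[OF rp] by (auto simp: one_ereal_def)
    have "ereal s \<le> fps_conv_radius q"
      unfolding fps_conv_radius_def
      using s q_bound[of s] q_nonneg by (intro conv_radius_ge_bounded) auto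
    then show ?thesis using s by (cases "fps_conv_radius q") (auto simp: one_ereal_def)
  qed
  have factor: "1 - p = (1 - fps_X) * q"
  proof (rule fps_ext)
    fix n show "fps_nth (1 - p) n = fps_nth ((1 - fps_X) * q) n"
      by (cases n) (auto simp: q_def algebra_simps fps_X_mult_nth p0)
  qed
  \<comment> \<open>differentiate the factorisation and evaluate at 1\<close>
  have q1: "eval_fps q 1 = eval_fps (fps_deriv p) 1"
  proof -
    have "- fps_deriv p = (1 - fps_X) * fps_deriv q - q"
      using arg_cong[OF factor, of fps_deriv] by (simp add: algebra_simps)
    then have eq: "fps_deriv p + (1 - fps_X) * fps_deriv q = q" by (simp add: algebra_simps)
    have rX: "fps_conv_radius (1 - fps_X :: real fps) = \<infinity>"
      using fps_conv_radius_diff[of 1 "fps_X :: real fps"] by simp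
    have r1: "1 < fps_conv_radius (fps_deriv p)" "1 < fps_conv_radius (fps_deriv q)"
      using rp rq fps_conv_radius_deriv[of p] fps_conv_radius_deriv[of q] by (auto intro: less_le_trans)
    then have r2: "1 < fps_conv_radius ((1 - fps_X) * fps_deriv q)"
      using fps_conv_radius_mult[of "1 - fps_X" "fps_deriv q"] rX by (auto intro: less_le_trans)
    have "eval_fps q 1 = eval_fps (fps_deriv p) 1 + eval_fps (1 - fps_X) 1 * eval_fps (fps_deriv q) 1"
      using r1 r2 rX by (subst eq[symmetric], subst eval_fps_add) (auto simp: eval_fps_mult one_ereal_def)
    also have "eval_fps (1 - fps_X) (1::real) = 0" by (simp add: eval_fps_diff)
    finally show ?thesis by simp
  qed
  have q_sums: "fps_nth q sums eval_fps q 1"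
    using sums_eval_fps[of "1::real" q] rq by (simp add: one_ereal_def)
  have q_pos: "0 < eval_fps q 1"
  proof -
    have "fps_nth q 0 \<le> eval_fps q 1"
      using sum_le_suminf[of "fps_nth q" "{0}"] q_sums q_nonneg by (auto simp: sums_iff)
    then show ?thesis by (simp add: q_def p0)
  qed
  then show "0 < eval_fps (fps_deriv p) 1" by (simp add: q1)

  have q_nz: "eval_fps (complex_fps q) z \<noteq> 0" if z: "norm z \<le> 1" for z
  proof
    assume zero: "eval_fps (complex_fps q) z = 0"
    have nz: "ereal (norm z) < fps_conv_radius p" "ereal (norm z) < fps_conv_radius q"
      using z rp rq by (metis ereal_less_eq(3) le_less_trans one_ereal_def)+
    have rX: "fps_conv_radius (1 - fps_X :: complex fps) = \<infinity>"
      using fps_conv_radius_diff[of 1 "fps_X :: complex fps"] by simp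
    have "1 - complex_fps p = (1 - fps_X) * complex_fps q"
    proof (rule fps_ext)
      fix n show "fps_nth (1 - complex_fps p) n = fps_nth ((1 - fps_X) * complex_fps q) n"
        using arg_cong[OF factor, of "\<lambda>f. complex_of_real (fps_nth f n)"]
        by (cases n) (auto simp: algebra_simps fps_X_mult_nth)
    qed
    then have "eval_fps (1 - complex_fps p) z = eval_fps (1 - fps_X) z * eval_fps (complex_fps q) z"
      using nz rX by (simp add: eval_fps_mult)
    then have Pz: "eval_fps (complex_fps p) z = 1"
      using nz zero by (simp add: eval_fps_diff)
    \<comment> \<open>the average of the numbers z ^ n with weights p n is 1, and they lie in the unit disc, so each
      of them with a positive weight equals 1\<close>
    have "(\<lambda>n. of_real (fps_nth p n) * z ^ n) sums 1"
      using sums_eval_fps[of z "complex_fps p"] nz Pz by simp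
    from sums_Re[OF this] have "(\<lambda>n. fps_nth p n * Re (z ^ n)) sums 1" by simp
    from sums_diff[OF p_sums1 this]
    have D: "(\<lambda>n. fps_nth p n * (1 - Re (z ^ n))) sums 0" by (simp add: algebra_simps)
    have norm_le: "norm (z ^ n) \<le> 1" for n
      using z by (simp add: norm_power power_le_one)
    have D_nonneg: "0 \<le> fps_nth p n * (1 - Re (z ^ n))" for n
      using p_nonneg[of n] norm_le[of n] complex_Re_le_cmod[of "z ^ n"] by (intro mult_nonneg_nonneg) auto
    have "z ^ n = 1" if "0 < fps_nth p n" for n
    proof -
      have "fps_nth p n * (1 - Re (z ^ n)) = 0"
        using suminf_eq_zero_iff[of "\<lambda>n. fps_nth p n * (1 - Re (z ^ n))"] D D_nonneg
        by (auto simp: sums_iff)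
      then have Re1: "Re (z ^ n) = 1" using that by simp
      moreover have "(Re (z ^ n))\<^sup>2 + (Im (z ^ n))\<^sup>2 \<le> 1"
        using norm_le[of n] unfolding cmod_def by simp
      ultimately show ?thesis by (simp add: complex_eq_iff)
    qed
    then have "z = 1" by (rule aperiodic)
    then show False using zero q_pos eval_complex_fps[of 1 q] rq by (simp add: one_ereal_def)
  qed

  \<comment> \<open>by compactness the nonvanishing persists on a slightly larger disc\<close>
  obtain r :: real where r: "1 < r" and r_nz: "\<And>z. norm z < r \<Longrightarrow> eval_fps (complex_fps q) z \<noteq> 0"
  proof -
    let ?Q = "eval_fps (complex_fps q)"
    define W where "W = eball 0 (fps_conv_radius q) \<inter> ?Q -` (- {0})"
    have "open W"
      unfolding W_def
      using continuous_on_eval_fps[of "complex_fps q"]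
      by (intro continuous_open_preimage) auto
    moreover have "cball 0 1 \<subseteq> W"
      using q_nz le_less_trans[OF _ rq] by (auto simp: W_def one_ereal_def)
    ultimately obtain e where e: "0 < e" "(\<Union>x\<in>cball 0 1. ball x e) \<subseteq> W"
      using compact_subset_open_imp_ball_epsilon_subset[of "cball (0::complex) 1" W] by auto
    show ?thesis
    proof (rule that[of "1 + e"])
      fix z :: complex assume z: "norm z < 1 + e"
      have "z \<in> (\<Union>x\<in>cball 0 1. ball x e)"
      proof (cases "norm z \<le> 1")
        case True
        then show ?thesis using e by (intro UN_I[of z]) auto
      next
        case False
        have "norm (sgn z - z) = \<bar>1 - norm z\<bar>"
        proof -
          have "z \<noteq> 0" using False by auto
          then have "sgn z - z = of_real (1 - norm z) * sgn z"
            by (simp add: sgn_eq field_simps)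
          then show ?thesis using False by (auto simp: norm_mult norm_sgn simp del: of_real_diff)
        qed
        then show ?thesis using False z
          by (intro UN_I[of "sgn z"]) (auto simp: norm_sgn dist_norm)
      qed
      then have "z \<in> W" using e by blast
      then show "?Q z \<noteq> 0" by (simp add: W_def)
    qed (use e in auto)
  qed

  define g where "g = complex_fps a / complex_fps q"
  have q0: "fps_nth (complex_fps q) 0 = 1" by (simp add: q_def p0)
  have pos: "0 < fps_conv_radius a" "0 < fps_conv_radius q"
    using less_trans[OF _ ra, of 0] less_trans[OF _ rq, of 0] by simp_all
  have pos_r: "0 < ereal r" using r by simp
  have nz: "eval_fps (complex_fps q) z \<noteq> 0" if "z \<in> eball 0 (ereal r)" for z
    using that r_nz by simp
  have "0 < fps_conv_radius (complex_fps a)" "0 < fps_conv_radius (complex_fps q)"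
    using pos by simp_all
  note divide = this pos_r nz
  have rg: "min (ereal r) (min (fps_conv_radius a) (fps_conv_radius q)) \<le> fps_conv_radius g"
    using fps_conv_radius_divide'[OF divide] by (simp add: g_def)
  have lt: "1 < min (ereal r) (min (fps_conv_radius a) (fps_conv_radius q))"
    using r ra rq by (simp add: one_ereal_def)
  have "eval_fps g 1 = eval_fps (complex_fps a) 1 / eval_fps (complex_fps q) 1"
    unfolding g_def using lt by (intro eval_fps_divide'[OF divide]) (simp_all add: one_ereal_def)
  then have eval_g: "eval_fps g 1 = of_real (eval_fps a 1 / eval_fps q 1)"
    using eval_complex_fps[of 1 a] eval_complex_fps[of 1 q] ra rq by (simp add: one_ereal_def)
  have "(u * (1 - fps_X)) * q = u * (1 - p)"
    by (simp only: factor mult.assoc)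
  also have "\<dots> = a"
    using renewal by (simp add: algebra_simps)
  finally have "(u * (1 - fps_X)) * q = a" .
  then have "complex_fps (u * (1 - fps_X)) * complex_fps q = complex_fps a"
    by (metis complex_fps_mult)
  then have g_eq: "g = complex_fps (u * (1 - fps_X))"
    using q0 by (metis g_def fps_divide_times_eq nonzero_mult_div_cancel_right fps_zero_nth zero_neq_one)
  have u_eq: "(\<Sum>k\<le>m. fps_nth g k) = of_real (fps_nth u m)" for m
    by (induction m) (simp_all add: g_eq algebra_simps fps_X_mult_right_nth)
  have "1 < fps_conv_radius g" using lt rg by (rule less_le_trans)
  then have "fps_nth g sums eval_fps g 1"
    using sums_eval_fps[of 1 g] by (simp add: one_ereal_def)
  then have "(\<lambda>m. \<Sum>k\<le>m. fps_nth g k) \<longlonglongrightarrow> eval_fps g 1"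
    by (simp add: sums_def_le)
  then have "(\<lambda>m. complex_of_real (fps_nth u m)) \<longlonglongrightarrow> of_real (eval_fps a 1 / eval_fps q 1)"
    by (simp only: u_eq eval_g)
  then show "(\<lambda>m. fps_nth u m) \<longlonglongrightarrow> eval_fps a 1 / eval_fps (fps_deriv p) 1"
    by (simp only: tendsto_of_real_iff q1)
qed


definition dilate_fps :: "'a :: comm_semiring_1 \<Rightarrow> 'a fps \<Rightarrow> 'a fps" where
  "dilate_fps c f = Abs_fps (\<lambda>n. fps_nth f n * c ^ n)"

lemma dilate_fps_nth [simp]: "fps_nth (dilate_fps c f) n = fps_nth f n * c ^ n"
  by (simp add: dilate_fps_def)

lemma dilate_fps_add: "dilate_fps c (f + g) = dilate_fps c f + dilate_fps c g"
  by (simp add: fps_eq_iff algebra_simps)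

lemma dilate_fps_mult: "dilate_fps c (f * g) = dilate_fps c f * dilate_fps c g"
proof (rule fps_ext)
  fix n
  have "(\<Sum>i=0..n. fps_nth f i * fps_nth g (n - i)) * c ^ n
      = (\<Sum>i=0..n. (fps_nth f i * c ^ i) * (fps_nth g (n - i) * c ^ (n - i)))"
    unfolding sum_distrib_right
  proof (rule sum.cong)
    fix i assume "i \<in> {0..n}"
    then have "c ^ n = c ^ i * c ^ (n - i)" by (simp flip: power_add)
    then show "fps_nth f i * fps_nth g (n - i) * c ^ n
        = (fps_nth f i * c ^ i) * (fps_nth g (n - i) * c ^ (n - i))"
      by (simp add: mult_ac)
  qed simp
  then show "fps_nth (dilate_fps c (f * g)) n = fps_nth (dilate_fps c f * dilate_fps c g) n"
    by (simp add: fps_mult_nth)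
qed

lemma eval_dilate_fps: "eval_fps (dilate_fps c f) z = eval_fps f (c * z)"
  by (simp add: eval_fps_def power_mult_distrib mult.assoc)

lemma fps_deriv_dilate: "fps_deriv (dilate_fps c f) = fps_const c * dilate_fps c (fps_deriv f)"
  by (simp add: fps_eq_iff mult_ac)

lemma fps_conv_radius_dilate:
  fixes f :: "real fps"
  assumes "0 < c" "ereal c < fps_conv_radius f"
  shows "1 < fps_conv_radius (dilate_fps c f)"
proof -
  have "fps_conv_radius (dilate_fps c f) = fps_conv_radius f / ereal c"
    using assms by (simp add: fps_conv_radius_def conv_radius_mult_power_right)
  then show ?thesis
    using assms by (simp add: ereal_less_divide_pos)
qed

text \<open>
  Rescaling the variable by \<open>\<rho>\<close> turns \<open>b\<close> into a probability distribution; its mean is \<open>\<rho> b' \<rho>\<close>.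
\<close>

theorem renewal_theorem:
  fixes a b u :: "real fps" and \<rho> :: real
  assumes b_nonneg: "\<And>n. 0 \<le> fps_nth b n" and b0: "fps_nth b 0 = 0"
    and \<rho>: "0 < \<rho>" and ra: "ereal \<rho> < fps_conv_radius a" and rb: "ereal \<rho> < fps_conv_radius b"
    and root: "eval_fps b \<rho> = 1"
    and aperiodic: "\<And>z::complex. (\<And>n. 0 < fps_nth b n \<Longrightarrow> z ^ n = 1) \<Longrightarrow> z = 1"
    and renewal: "u = a + u * b"
  shows "(\<lambda>m. fps_nth u m * \<rho> ^ m) \<longlonglongrightarrow> eval_fps a \<rho> / (\<rho> * eval_fps (fps_deriv b) \<rho>)"
    and "0 < eval_fps (fps_deriv b) \<rho>"
proof -
  let ?a = "dilate_fps \<rho> a" and ?p = "dilate_fps \<rho> b" and ?u = "dilate_fps \<rho> u"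
  have p_nonneg: "0 \<le> fps_nth ?p n" for n using b_nonneg \<rho> by simp
  have p_aper: "z = 1" if "\<And>n. 0 < fps_nth ?p n \<Longrightarrow> z ^ n = 1" for z :: complex
    by (rule aperiodic, rule that) (simp add: \<rho>)
  have ren: "?u = ?a + ?u * ?p"
    using arg_cong[OF renewal, of "dilate_fps \<rho>"] by (simp only: dilate_fps_add dilate_fps_mult)
  have "ereal (norm \<rho>) < fps_conv_radius (fps_deriv b)"
    using \<rho> rb fps_conv_radius_deriv[of b] by (auto intro: less_le_trans)
  then have r': "1 < fps_conv_radius (dilate_fps \<rho> (fps_deriv b))"
    using \<rho> by (intro fps_conv_radius_dilate) auto
  have deriv_p: "eval_fps (fps_deriv ?p) 1 = \<rho> * eval_fps (fps_deriv b) \<rho>"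
    using r' by (simp add: fps_deriv_dilate eval_fps_mult eval_dilate_fps one_ereal_def)
  have p0: "fps_nth ?p 0 = 0" and p1: "eval_fps ?p 1 = 1"
    using b0 root by (simp_all add: eval_dilate_fps)
  note R = renewal_limit[OF p_nonneg p0 fps_conv_radius_dilate[OF \<rho> ra]
      fps_conv_radius_dilate[OF \<rho> rb] p1 p_aper ren]
  show "(\<lambda>m. fps_nth u m * \<rho> ^ m) \<longlonglongrightarrow> eval_fps a \<rho> / (\<rho> * eval_fps (fps_deriv b) \<rho>)"
    using R(1) by (simp add: deriv_p eval_dilate_fps)
  show "0 < eval_fps (fps_deriv b) \<rho>"
    using R(2) \<rho> by (simp add: deriv_p zero_less_mult_iff)
qed

lemma fps_conv_radius_mono:
  fixes f g :: "real fps"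
  assumes "\<And>n. \<bar>fps_nth f n\<bar> \<le> fps_nth g n"
  shows "fps_conv_radius g \<le> fps_conv_radius f"
  unfolding fps_conv_radius_def
proof (rule conv_radius_geI_ex')
  fix r :: real assume r: "0 < r" "ereal r < conv_radius (fps_nth g)"
  show "summable (\<lambda>n. fps_nth f n * of_real r ^ n)"
  proof (rule summable_comparison_test')
    show "summable (\<lambda>n. fps_nth g n * r ^ n)"
      using r by (intro summable_in_conv_radius) simp
    show "norm (fps_nth f n * of_real r ^ n) \<le> fps_nth g n * r ^ n" for n
      using r assms[of n] by (simp add: abs_mult mult_right_mono)
  qed
qed

lemma eval_fps_ge_term:
  fixes f :: "real fps"
  assumes "\<And>n. 0 \<le> fps_nth f n" "0 \<le> t" "ereal t < fps_conv_radius f"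
  shows "fps_nth f n * t ^ n \<le> eval_fps f t"
proof -
  have "(\<lambda>k. fps_nth f k * t ^ k) sums eval_fps f t"
    using assms by (intro sums_eval_fps) simp
  then show ?thesis
    using assms sum_le_suminf[of "\<lambda>k. fps_nth f k * t ^ k" "{n}"] by (auto simp: sums_iff)
qed

lemma eval_fps_strict_mono:
  fixes f :: "real fps"
  assumes nonneg: "\<And>n. 0 \<le> fps_nth f n" and pos: "0 < fps_nth f n" "0 < n"
    and t: "0 \<le> s" "s < t" "ereal t < fps_conv_radius f"
  shows "eval_fps f s < eval_fps f t"
proof -
  have rs: "ereal s < fps_conv_radius f" using t by (meson ereal_less_eq(3) le_less_trans less_imp_le)
  have "(\<lambda>k. fps_nth f k * t ^ k - fps_nth f k * s ^ k) sums (eval_fps f t - eval_fps f s)"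
    using t rs by (intro sums_diff sums_eval_fps) auto
  then have D: "(\<lambda>k. fps_nth f k * (t ^ k - s ^ k)) sums (eval_fps f t - eval_fps f s)"
    by (simp add: right_diff_distrib)
  have D_nonneg: "0 \<le> fps_nth f k * (t ^ k - s ^ k)" for k
    using t nonneg[of k] power_mono[of s t k] by simp
  have "0 < fps_nth f n * (t ^ n - s ^ n)"
    using t pos power_strict_mono[of s t n] by simp
  also have "\<dots> \<le> eval_fps f t - eval_fps f s"
    using sum_le_suminf[of "\<lambda>k. fps_nth f k * (t ^ k - s ^ k)" "{n}"] D D_nonneg
    by (auto simp: sums_iff)
  finally show ?thesis by simp
qed

text \<open>
  The values of \<open>f\<close> increase from \<open>0\<close>, so by continuity they pass \<open>1\<close> unless they stay below \<open>1\<close>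
  throughout the disc of convergence. An entire \<open>f\<close> with a positive coefficient is unbounded. For a
  finite radius \<open>r\<close>, the bound \<open>1\<close> would carry over to the partial sums at \<open>r\<close>, and the series would
  converge there.
\<close>

lemma eval_fps_eq_1_root:
  fixes f :: "real fps"
  assumes nonneg: "\<And>n. 0 \<le> fps_nth f n" and f0: "fps_nth f 0 = 0"
    and pos: "0 < fps_nth f n" and radius_pos: "0 < fps_conv_radius f"
    and unbounded: "\<And>r. 0 < r \<Longrightarrow> fps_conv_radius f = ereal r \<Longrightarrow> \<not> summable (\<lambda>k. fps_nth f k * r ^ k)"
  shows "\<exists>t>0. ereal t < fps_conv_radius f \<and> eval_fps f t = 1"
proof (rule ccontr)
  assume none: "\<not> ?thesis"
  have n: "0 < n" using pos f0 by (cases n) auto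
  have lt1: "eval_fps f t < 1" if t: "0 < t" "ereal t < fps_conv_radius f" for t
  proof (rule ccontr)
    assume "\<not> eval_fps f t < 1"
    moreover have "continuous_on {0..t} (eval_fps f)"
    proof (rule continuous_on_subset[OF continuous_on_eval_fps])
      show "{0..t} \<subseteq> eball 0 (fps_conv_radius f)"
        using le_less_trans[OF _ t(2)] by auto
    qed
    ultimately obtain s where s: "0 \<le> s" "s \<le> t" "eval_fps f s = 1"
      using IVT'[of "eval_fps f" 0 1 t] t by (auto simp: eval_fps_at_0 f0)
    moreover have "s \<noteq> 0" using s by (auto simp: eval_fps_at_0 f0)
    moreover have "ereal s < fps_conv_radius f"
      using s t by (meson ereal_less_eq(3) le_less_trans)
    ultimately show False using none by (auto simp: less_le)
  qed
  show False
  proof (cases "fps_conv_radius f")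
    case PInf
    define t where "t = max 1 (1 / fps_nth f n)"
    have t1: "1 \<le> t" by (simp add: t_def)
    have "1 \<le> fps_nth f n * t" using pos by (auto simp: t_def field_simps max_def)
    also have "\<dots> \<le> fps_nth f n * t ^ n"
      using pos n self_le_power[of t n] by (simp add: t_def)
    also have "\<dots> \<le> eval_fps f t"
      using nonneg PInf t1 by (intro eval_fps_ge_term) simp_all
    finally show False using lt1[of t] PInf t1 by simp
  next
    case (real r)
    then have r: "0 < r" using radius_pos by simp
    have "(\<Sum>k<m. fps_nth f k * r ^ k) \<le> 1" for m
    proof (rule tendsto_upperbound)
      show "((\<lambda>t. \<Sum>k<m. fps_nth f k * t ^ k) \<longlongrightarrow> (\<Sum>k<m. fps_nth f k * r ^ k)) (at_left r)"
        by (intro tendsto_intros)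
      have "(\<Sum>k<m. fps_nth f k * t ^ k) \<le> 1" if t: "0 < t" "t < r" for t
      proof -
        have "(\<lambda>k. fps_nth f k * t ^ k) sums eval_fps f t"
          using t real by (intro sums_eval_fps) simp
        then have "(\<Sum>k<m. fps_nth f k * t ^ k) \<le> eval_fps f t"
          using nonneg t sum_le_suminf[of "\<lambda>k. fps_nth f k * t ^ k" "{..<m}"] by (auto simp: sums_iff)
        then show ?thesis using lt1[of t] t real by simp
      qed
      then show "\<forall>\<^sub>F t in at_left r. (\<Sum>k<m. fps_nth f k * t ^ k) \<le> 1"
        using r by (auto simp: eventually_at_left_field)
    qed auto
    then have "summable (\<lambda>k. fps_nth f k * r ^ k)"
      using nonneg r by (intro summableI_nonneg_bounded) auto
    then show False using unbounded r real by blast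
  next
    case MInf
    then show False using radius_pos by simp
  qed
qed

section \<open>Weighted words\<close>

definition weight :: "('a \<Rightarrow> real) \<Rightarrow> 'a list \<Rightarrow> real" where
  "weight wt w = prod_list (map wt w)"

lemma weight_simps [simp]:
  "weight wt [] = 1" "weight wt (s # w) = wt s * weight wt w"
  "weight wt (u @ v) = weight wt u * weight wt v"
  by (simp_all add: weight_def)

definition level :: "'a list set \<Rightarrow> nat \<Rightarrow> 'a list set" where
  "level C n = {w \<in> C. length w = n}"

lemma finite_level [simp]: "finite (level (C :: 'a::finite list set) n)"
  by (rule finite_subset[OF _ finite_lists_length_eq[of UNIV n]]) (auto simp: level_def)

lemma split_at_penultimate:
  assumes "w \<noteq> []" "last w = \<theta>" "count_list w \<theta> \<noteq> 1"
  obtains u v where "w = u @ v" "u \<noteq> []" "last u = \<theta>" "v \<noteq> []" "last v = \<theta>" "count_list v \<theta> = 1"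
proof -
  have w: "w = butlast w @ [\<theta>]" using assms by (metis append_butlast_last_id)
  then have "\<theta> \<in> set (butlast w)"
    using assms(3) by (metis add_0 count_list.simps count_list_append count_notin One_nat_def)
  then obtain ys zs where "butlast w = ys @ \<theta> # zs" "\<theta> \<notin> set zs"
    by (meson split_list_last)
  then have "w = (ys @ [\<theta>]) @ (zs @ [\<theta>])" "count_list (zs @ [\<theta>]) \<theta> = 1"
    using w by (auto simp: count_notin)
  then show thesis using that[of "ys @ [\<theta>]" "zs @ [\<theta>]"] by simp
qed

section \<open>Words obeying a two-step rule\<close>

locale weighted_rule =
  fixes R :: "'a::finite \<Rightarrow> 'a \<Rightarrow> bool" and wt :: "'a \<Rightarrow> real" and \<theta> :: 'a
  assumes wt_pos: "0 < wt s"
begin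

definition total :: "'a list set \<Rightarrow> nat \<Rightarrow> real" where
  "total C n = (\<Sum>w\<in>level C n. weight wt w)"

definition ending :: "'a list set" where
  "ending = {w. w \<noteq> [] \<and> successively R w \<and> last w = \<theta>}"

definition arrival :: "'a list set" where
  "arrival = {w \<in> ending. count_list w \<theta> = 1}"

definition return :: "'a list set" where
  "return = {w \<in> arrival. R \<theta> (hd w)}"

definition avoiding :: "'a list set" where
  "avoiding = {w. successively R w \<and> \<theta> \<notin> set w}"

lemma weight_pos: "0 < weight wt w"
  by (induction w) (auto simp: wt_pos)

lemma total_nonneg: "0 \<le> total C n"
  unfolding total_def by (intro sum_nonneg less_imp_le[OF weight_pos])

lemma total_pos: "w \<in> C \<Longrightarrow> length w = n \<Longrightarrow> 0 < total C n"
  unfolding total_def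
  by (rule sum_pos2[OF finite_level, of w]) (auto simp: level_def weight_pos less_imp_le[OF weight_pos])

text \<open>
  The tool for comparing two classes of words: an injection of one into the other that
  multiplies every weight by the same constant.
\<close>

lemma total_embed:
  assumes "inj_on h (level C n)" "h ` level C n \<subseteq> level D m"
    and "\<And>w. w \<in> level C n \<Longrightarrow> weight wt (h w) = c * weight wt w"
  shows "c * total C n \<le> total D m"
proof -
  have "c * total C n = (\<Sum>w\<in>level C n. weight wt (h w))"
    using assms(3) by (simp add: total_def sum_distrib_left)
  also have "\<dots> = (\<Sum>w\<in>h ` level C n. weight wt w)"
    using assms(1) by (simp add: sum.reindex)
  also have "\<dots> \<le> total D m"
    unfolding total_def using assms(2) by (intro sum_mono2) (auto intro: less_imp_le[OF weight_pos])
  finally show ?thesis .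
qed

lemma total_mono: "C \<subseteq> D \<Longrightarrow> total C n \<le> total D n"
  using total_embed[of id C n D n 1] by (auto simp: level_def)

text \<open>
  Cutting a word that avoids \<open>\<theta>\<close> leaves two such words. Equality fails only because the two pieces of an
  arbitrary pair need not be joinable. This submultiplicativity is what turns smallness of a single
  total into exponential decay.
\<close>

lemma total_avoiding_submult:
  "total avoiding (m + n) \<le> total avoiding m * total avoiding n"
proof -
  let ?cut = "\<lambda>w. (take m w, drop m w)"
  have inj: "inj_on ?cut (level avoiding (m + n))"
    by (rule inj_onI) (metis Pair_inject append_take_drop_id)
  have "total avoiding (m + n)
      = (\<Sum>w\<in>level avoiding (m + n). case ?cut w of (u, v) \<Rightarrow> weight wt u * weight wt v)"
    unfolding total_def by (simp flip: weight_simps(3))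
  also have "\<dots> = (\<Sum>(u, v)\<in>?cut ` level avoiding (m + n). weight wt u * weight wt v)"
    by (simp only: sum.reindex[OF inj] o_def)
  also have "\<dots> \<le> (\<Sum>(u, v)\<in>level avoiding m \<times> level avoiding n. weight wt u * weight wt v)"
  proof (rule sum_mono2)
    have "(take m w, drop m w) \<in> level avoiding m \<times> level avoiding n"
      if "w \<in> level avoiding (m + n)" for w
    proof -
      have "successively R (take m w @ drop m w)"
        using that by (simp add: level_def avoiding_def)
      then show ?thesis
        using that unfolding successively_append_iff
        by (auto simp: level_def avoiding_def dest: in_set_takeD in_set_dropD)
    qed
    then show "?cut ` level avoiding (m + n) \<subseteq> level avoiding m \<times> level avoiding n"
      by blast
  qed (auto intro: mult_nonneg_nonneg less_imp_le[OF weight_pos])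
  also have "\<dots> = total avoiding m * total avoiding n"
    by (simp add: total_def sum_product sum.cartesian_product)
  finally show ?thesis .
qed

lemma total_arrival_Suc: "total arrival (Suc n) \<le> wt \<theta> * total avoiding n"
proof -
  have dec: "w = butlast w @ [\<theta>]" "\<theta> \<notin> set (butlast w)" "successively R (butlast w)"
    if "w \<in> arrival" for w
  proof -
    show w: "w = butlast w @ [\<theta>]"
      using that by (auto simp: arrival_def ending_def)
    have "count_list (butlast w @ [\<theta>]) \<theta> = 1" "successively R (butlast w @ [\<theta>])"
      using that w by (auto simp: arrival_def ending_def)
    then show "\<theta> \<notin> set (butlast w)" "successively R (butlast w)"
      by (auto simp: count_list_0_iff successively_append_iff)
  qed
  have "1 / wt \<theta> * total arrival (Suc n) \<le> total avoiding n"
  proof (rule total_embed)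
    show "inj_on butlast (level arrival (Suc n))"
      by (rule inj_onI) (metis (mono_tags, lifting) dec(1) level_def mem_Collect_eq)
    show "butlast ` level arrival (Suc n) \<subseteq> level avoiding n"
      using dec by (auto simp: level_def avoiding_def)
    fix w assume "w \<in> level arrival (Suc n)"
    then have "weight wt w = weight wt (butlast w @ [\<theta>])" using dec by (simp add: level_def)
    then show "weight wt (butlast w) = 1 / wt \<theta> * weight wt w"
      using wt_pos[of \<theta>] by simp
  qed
  then show ?thesis using wt_pos[of \<theta>] by (simp add: field_simps)
qed

lemma total_arrival_0: "total arrival 0 = 0"
  by (simp add: total_def level_def arrival_def ending_def)

lemma total_return_le_arrival: "total return n \<le> total arrival n"
  by (rule total_mono) (auto simp: return_def)

lemma ending_append_return:
  assumes "u \<in> ending" "v \<in> return"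
  shows "u @ v \<in> ending - arrival"
proof -
  have "count_list u \<theta> \<noteq> 0"
    using assms(1) by (auto simp: ending_def count_list_0_iff)
  then show ?thesis
    using assms by (auto simp: ending_def return_def arrival_def successively_append_iff)
qed

lemma ending_minus_arrival_split:
  assumes "w \<in> ending - arrival"
  obtains u v where "w = u @ v" "u \<in> ending" "v \<in> return"
proof -
  have "w \<noteq> []" "last w = \<theta>" "count_list w \<theta> \<noteq> 1"
    using assms by (auto simp: ending_def arrival_def)
  then obtain u v where "w = u @ v" "u \<noteq> []" "last u = \<theta>" "v \<noteq> []" "last v = \<theta>" "count_list v \<theta> = 1"
    by (rule split_at_penultimate)
  with assms show thesis
    by (intro that) (auto simp: ending_def return_def arrival_def successively_append_iff)
qed

lemma append_return_unique:
  assumes "u @ v = u' @ v'" "u \<in> ending" "u' \<in> ending" "v \<in> return" "v' \<in> return"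
  shows "u = u' \<and> v = v'"
proof -
  have no_overlap: "z = []" if "x = y @ z" "z @ s = s'" "x \<in> ending" "s \<in> return" "s' \<in> return"
    for x y z s s'
  proof (rule ccontr)
    assume "z \<noteq> []"
    then have "\<theta> \<in> set z" using that by (auto simp: ending_def)
    then have "count_list z \<theta> \<noteq> 0" by (simp add: count_list_0_iff)
    then show False using that by (auto simp: return_def arrival_def)
  qed
  obtain z where "u = u' @ z \<and> z @ v = v' \<or> u @ z = u' \<and> v = z @ v'"
    using assms(1) by (auto simp: append_eq_append_conv2)
  then show ?thesis
  proof
    assume z: "u = u' @ z \<and> z @ v = v'"
    then have "z = []" using assms by (intro no_overlap[of u u' z v v']) simp_all
    with z show ?thesis by simp
  next
    assume z: "u @ z = u' \<and> v = z @ v'"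
    then have "z = []" using assms by (intro no_overlap[of u' u z v' v]) simp_all
    with z show ?thesis by simp
  qed
qed

text \<open>
  A word ending in \<open>\<theta>\<close> either has no earlier \<open>\<theta>\<close>, or splits uniquely just after the last but one
  \<open>\<theta>\<close> into a shorter word ending in \<open>\<theta>\<close> and a return to \<open>\<theta>\<close>.
\<close>

lemma total_ending_renewal:
  "total ending m = total arrival m + (\<Sum>k=0..m. total ending k * total return (m - k))"
proof -
  let ?I = "Sigma {0..m} (\<lambda>k. level ending k \<times> level return (m - k))"
  let ?join = "\<lambda>(k::nat, u, v). u @ v :: 'a list"
  have "bij_betw ?join ?I (level (ending - arrival) m)"
    unfolding bij_betw_def
  proof
    show "inj_on ?join ?I"
      by (rule inj_onI) (auto simp: level_def dest: append_return_unique)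
    show "?join ` ?I = level (ending - arrival) m"
    proof
      show "?join ` ?I \<subseteq> level (ending - arrival) m"
        by (auto simp: level_def dest: ending_append_return)
      show "level (ending - arrival) m \<subseteq> ?join ` ?I"
      proof
        fix w assume "w \<in> level (ending - arrival) m"
        then have m: "length w = m" and "w \<in> ending - arrival" by (auto simp: level_def)
        from this(2) obtain u v where "w = u @ v" "u \<in> ending" "v \<in> return"
          by (rule ending_minus_arrival_split)
        with m have "w = ?join (length u, u, v)" "(length u, u, v) \<in> ?I"
          by (auto simp: level_def)
        then show "w \<in> ?join ` ?I" by blast
      qed
    qed
  qed
  then have "total (ending - arrival) m = (\<Sum>i\<in>?I. weight wt (?join i))"
    unfolding total_def by (rule sum.reindex_bij_betw[symmetric])
  also have "\<dots> = (\<Sum>k=0..m. \<Sum>(u, v)\<in>level ending k \<times> level return (m - k). weight wt u * weight wt v)"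
    by (subst sum.Sigma) (auto intro!: sum.cong)
  also have "\<dots> = (\<Sum>k=0..m. total ending k * total return (m - k))"
    by (simp add: total_def sum_product sum.cartesian_product)
  finally have "total (ending - arrival) m = (\<Sum>k=0..m. total ending k * total return (m - k))" .
  moreover have "total ending m = total arrival m + total (ending - arrival) m"
  proof -
    have "level ending m = level arrival m \<union> level (ending - arrival) m"
      by (auto simp: level_def arrival_def)
    then show ?thesis
      unfolding total_def by (simp only:, intro sum.union_disjoint finite_level) (auto simp: level_def)
  qed
  ultimately show ?thesis by simp
qed

definition gf :: "'a list set \<Rightarrow> real fps" where
  "gf C = Abs_fps (total C)"

lemma gf_nth [simp]: "fps_nth (gf C) n = total C n"
  by (simp add: gf_def)

lemma gf_renewal: "gf ending = gf arrival + gf ending * gf return"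
  by (rule fps_ext) (simp add: fps_mult_nth flip: total_ending_renewal)

lemma radius_return_ge_arrival: "fps_conv_radius (gf arrival) \<le> fps_conv_radius (gf return)"
  by (rule fps_conv_radius_mono) (simp add: total_nonneg total_return_le_arrival)

text \<open>
  If one total \<open>S N\<close> of words avoiding \<open>\<theta>\<close> satisfies \<open>S N * t ^ N < 1\<close>, then the same holds for some \<open>s > t\<close>,
  and by submultiplicativity all the \<open>S n * s ^ n\<close> are bounded by the first \<open>N\<close> of them. An arrival is a
  word avoiding \<open>\<theta>\<close> followed by \<open>\<theta>\<close>, so its series inherits the bound.
\<close>

lemma radius_arrival_gt:
  assumes t: "0 < t" and N: "0 < N" and small: "total avoiding N * t ^ N < 1"
  shows "ereal t < fps_conv_radius (gf arrival)"
proof -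
  let ?S = "total avoiding"
  have "((\<lambda>s. ?S N * s ^ N) \<longlongrightarrow> ?S N * t ^ N) (at_right t)"
    by (intro tendsto_intros)
  then have "\<forall>\<^sub>F s in at_right t. ?S N * s ^ N < 1 \<and> t < s"
    using small by (intro eventually_conj order_tendstoD(2) eventually_at_right_less)
  then obtain s where s: "?S N * s ^ N < 1" "t < s"
    using eventually_happens[of _ "at_right t"] by auto
  define K where "K = (\<Sum>r<N. ?S r * s ^ r)"
  have bound: "?S n * s ^ n \<le> K" for n
  proof (induction n rule: less_induct)
    case (less n)
    show ?case
    proof (cases "n < N")
      case True
      then show ?thesis
        unfolding K_def using t s
        by (intro member_le_sum) (auto intro: mult_nonneg_nonneg total_nonneg)
    next
      case False
      then have n: "n = N + (n - N)" by simp
      have "?S n * s ^ n \<le> (?S N * ?S (n - N)) * s ^ n"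
        using t s total_avoiding_submult[of N "n - N"] n by (intro mult_right_mono) auto
      also have "\<dots> = (?S N * s ^ N) * (?S (n - N) * s ^ (n - N))"
        by (subst (2) n) (simp add: power_add)
      also have "\<dots> \<le> 1 * (?S (n - N) * s ^ (n - N))"
        using s t by (intro mult_right_mono mult_nonneg_nonneg total_nonneg) auto
      also have "\<dots> \<le> K" using less[of "n - N"] False N by simp
      finally show ?thesis .
    qed
  qed
  have K: "0 \<le> K" using bound[of 0] total_nonneg[of avoiding 0] by simp
  have "ereal s \<le> fps_conv_radius (gf arrival)"
    unfolding fps_conv_radius_def
  proof (rule conv_radius_ge_bounded)
    show "0 < s" using s t by simp
    show "norm (fps_nth (gf arrival) n) * s ^ n \<le> wt \<theta> * s * K" for n
    proof (cases n)
      case 0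
      then show ?thesis using K s t wt_pos[of \<theta>] by (simp add: total_arrival_0)
    next
      case (Suc k)
      have "total arrival (Suc k) * s ^ Suc k \<le> (wt \<theta> * ?S k) * s ^ Suc k"
        using s t by (intro mult_right_mono total_arrival_Suc) auto
      also have "\<dots> = wt \<theta> * s * (?S k * s ^ k)" by simp
      also have "\<dots> \<le> wt \<theta> * s * K"
        using s t wt_pos[of \<theta>] by (intro mult_left_mono bound) auto
      finally show ?thesis using Suc by (simp add: total_nonneg)
    qed
  qed
  then show ?thesis using s by (metis ereal_less_eq(3) less_ereal.simps(1) less_le_trans)
qed

lemma radius_arrival_pos: "0 < fps_conv_radius (gf arrival)"
proof -
  let ?t = "1 / (total avoiding 1 + 1)"
  have "ereal ?t < fps_conv_radius (gf arrival)"
    using total_nonneg[of avoiding 1] by (intro radius_arrival_gt[of _ 1]) auto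
  moreover have "0 < ?t" using total_nonneg[of avoiding 1] by simp
  ultimately show ?thesis by (metis ereal_less(2) less_trans)
qed

end

section \<open>Primitive rules\<close>

locale primitive_weighted_rule = weighted_rule +
  assumes primitive: "\<exists>k>0. \<forall>i j. \<exists>w. length w = k \<and> successively R (i # w) \<and> last (i # w) = j"
begin

lemma path_from_\<theta>:
  assumes "i \<noteq> \<theta>"
  obtains p where "\<theta> \<notin> set p" "successively R (\<theta> # p @ [i])"
proof -
  obtain w where w: "successively R (\<theta> # w)" "last (\<theta> # w) = i" using primitive by blast
  obtain ys zs where z: "\<theta> # w = ys @ \<theta> # zs" "\<theta> \<notin> set zs"
    using split_list_last[of \<theta> "\<theta> # w"] by auto
  have "zs \<noteq> []" "last zs = i" using w(2) z(1) assms by (auto split: if_splits)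
  then have "zs = butlast zs @ [i]" by auto
  moreover have "successively R (\<theta> # zs)" using w(1) z(1) by (metis successively_append_iff)
  ultimately show thesis using z(2) by (metis that in_set_butlastD)
qed

lemma path_to_\<theta>:
  assumes "j \<noteq> \<theta>"
  obtains q where "\<theta> \<notin> set q" "successively R (j # q @ [\<theta>])"
proof -
  obtain w where w: "successively R (j # w)" "last (j # w) = \<theta>" using primitive by blast
  then have "\<theta> \<in> set (j # w)" by (metis last_in_set list.distinct(1))
  then obtain ys zs where z: "j # w = ys @ \<theta> # zs" "\<theta> \<notin> set ys"
    by (meson split_list_first)
  then obtain q where q: "ys = j # q" using assms by (cases ys) auto
  have "successively R ((ys @ [\<theta>]) @ zs)" using w(1) z(1) by simp
  then have "successively R (ys @ [\<theta>])" by (simp only: successively_append_iff)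
  then have "successively R (j # q @ [\<theta>])" using q by simp
  then show thesis using z(2) q that by auto
qed

text \<open>
  Every word that avoids \<open>\<theta>\<close> can be completed to a return by a prefix and a suffix that depend only on
  its first and last step. For fixed first and last step this shifts the length by a constant and
  multiplies the weight by a constant, so words avoiding \<open>\<theta>\<close> are no heavier than returns, up to a
  constant, and there are finitely many pairs of end steps.
\<close>

lemma avoiding_tends_to_0:
  assumes t: "0 < t" and lim: "(\<lambda>n. total return n * t ^ n) \<longlonglongrightarrow> 0"
  shows "(\<lambda>n. total avoiding n * t ^ n) \<longlonglongrightarrow> 0"
proof -
  define S where "S e = {u \<in> avoiding. u \<noteq> [] \<and> (hd u, last u) = e}" for e
  have part: "(\<lambda>n. total (S (i, j)) n * t ^ n) \<longlonglongrightarrow> 0" for i j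
  proof (cases "i = \<theta> \<or> j = \<theta>")
    case True
    then have "S (i, j) = {}" by (auto simp: S_def avoiding_def)
    then show ?thesis by (simp add: total_def level_def)
  next
    case False
    obtain p where p: "\<theta> \<notin> set p" "successively R (\<theta> # p @ [i])"
      using False path_from_\<theta> by blast
    obtain q where q: "\<theta> \<notin> set q" "successively R (j # q @ [\<theta>])"
      using False path_to_\<theta> by blast
    define v where "v = q @ [\<theta>]"
    define L where "L = length p + length v"
    define c where "c = weight wt p * weight wt v"
    have c: "0 < c" by (simp add: c_def weight_pos)
    have le: "c * total (S (i, j)) n \<le> total return (n + L)" for n
    proof (rule total_embed)
      show "inj_on (\<lambda>u. p @ u @ v) (level (S (i, j)) n)" by (rule inj_onI) simp
      show "(\<lambda>u. p @ u @ v) ` level (S (i, j)) n \<subseteq> level return (n + L)"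
      proof
        fix w assume "w \<in> (\<lambda>u. p @ u @ v) ` level (S (i, j)) n"
        then obtain u where u: "w = p @ u @ v" "u \<in> S (i, j)" "length u = n"
          by (auto simp: level_def)
        then have u': "u \<noteq> []" "hd u = i" "last u = j" "successively R u" "\<theta> \<notin> set u"
          by (auto simp: S_def avoiding_def)
        moreover have "successively R (\<theta> # p)" "R (last (\<theta> # p)) i"
          using p(2) successively_append_iff[of R "\<theta> # p" "[i]"] by simp_all
        moreover have "successively R v" "R j (hd v)" "v \<noteq> []"
          using q(2) successively_append_iff[of R "[j]" v] by (simp_all add: v_def)
        ultimately have "successively R ((\<theta> # p) @ u @ v)"
          by (simp add: successively_append_iff del: append_Cons last.simps)
        then have "successively R (\<theta> # p @ u @ v)" by simp
        then have "successively R (p @ u @ v)" "R \<theta> (hd (p @ u @ v))"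
          using \<open>u \<noteq> []\<close> by (auto simp: successively_Cons)
        then show "w \<in> level return (n + L)"
          using u p(1) q(1) \<open>\<theta> \<notin> set u\<close>
          by (auto simp: level_def return_def arrival_def ending_def v_def L_def count_notin)
      qed
    qed (simp add: c_def)
    show ?thesis
    proof (rule tendsto_sandwich[where f = "\<lambda>_. 0"
          and h = "\<lambda>n. total return (n + L) * t ^ (n + L) / (c * t ^ L)"])
      show "(\<lambda>n. total return (n + L) * t ^ (n + L) / (c * t ^ L)) \<longlonglongrightarrow> 0"
        using LIMSEQ_ignore_initial_segment[OF lim, of L] by (intro tendsto_divide_zero)
      show "\<forall>\<^sub>F n in sequentially. total (S (i, j)) n * t ^ n \<le> total return (n + L) * t ^ (n + L) / (c * t ^ L)"
      proof (rule always_eventually, rule allI)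
        fix n
        have "(c * total (S (i, j)) n) * (t ^ n * t ^ L) \<le> total return (n + L) * (t ^ n * t ^ L)"
          using t le[of n] by (intro mult_right_mono) auto
        then show "total (S (i, j)) n * t ^ n \<le> total return (n + L) * t ^ (n + L) / (c * t ^ L)"
          using c t by (simp add: field_simps power_add)
      qed
      show "\<forall>\<^sub>F n in sequentially. 0 \<le> total (S (i, j)) n * t ^ n"
        using t by (intro always_eventually allI mult_nonneg_nonneg total_nonneg) auto
    qed simp
  qed
  have "(\<lambda>n. total (S e) n * t ^ n) \<longlonglongrightarrow> 0" for e
    using part[of "fst e" "snd e"] by simp
  then have "(\<lambda>n. \<Sum>e\<in>UNIV. total (S e) n * t ^ n) \<longlonglongrightarrow> 0"
    by (intro tendsto_null_sum)
  moreover have "\<forall>\<^sub>F n in sequentially. (\<Sum>e\<in>UNIV. total (S e) n * t ^ n) = total avoiding n * t ^ n"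
    using eventually_gt_at_top[of 0]
  proof eventually_elim
    case (elim n)
    have "level (S e) n = {u \<in> level avoiding n. (hd u, last u) = e}" for e
      using elim by (auto simp: S_def level_def)
    then have "(\<Sum>e\<in>UNIV. total (S e) n) = total avoiding n"
      unfolding total_def by (simp only: sum.group[OF finite_level finite_class.finite_UNIV subset_UNIV])
    then show ?case by (simp flip: sum_distrib_right)
  qed
  ultimately show ?thesis by (simp add: tendsto_cong)
qed

text \<open>
  The gap that makes everything work: mere boundary convergence of the return series at \<open>t\<close> already
  forces convergence beyond \<open>t\<close>. So the return series cannot converge on the boundary of its disc of
  convergence, and the arrival series converges at every point inside the disc of the return series.
\<close>

lemma radius_arrival_gt_of_return_tends_to_0:
  assumes t: "0 < t" and lim: "(\<lambda>n. total return n * t ^ n) \<longlonglongrightarrow> 0"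
  shows "ereal t < fps_conv_radius (gf arrival)"
proof -
  have "\<forall>\<^sub>F n in sequentially. total avoiding n * t ^ n < 1 \<and> 0 < n"
    using avoiding_tends_to_0[OF assms]
    by (intro eventually_conj order_tendstoD(2) eventually_gt_at_top) auto
  then obtain N where "total avoiding N * t ^ N < 1" "0 < N"
    by (auto simp: eventually_sequentially)
  then show ?thesis using t by (intro radius_arrival_gt)
qed

text \<open>
  A closed walk at \<open>\<theta>\<close> is a concatenation of returns, so every period of the return lengths is a period
  of the lengths of closed walks.
\<close>

lemma pow_eq_1_on_closed:
  fixes z :: complex
  assumes ret: "\<And>n. 0 < total return n \<Longrightarrow> z ^ n = 1"
    and "w \<in> ending" "R \<theta> (hd w)"
  shows "z ^ length w = 1"
  using assms(2,3)
proof (induction w rule: length_induct)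
  case (1 w)
  show ?case
  proof (cases "w \<in> arrival")
    case True
    then have "w \<in> return" using 1 by (simp add: return_def)
    then have "0 < total return (length w)" by (intro total_pos) auto
    then show ?thesis by (rule ret)
  next
    case False
    then have "w \<in> ending - arrival" using 1 by simp
    then obtain u v where uv: "w = u @ v" "u \<in> ending" "v \<in> return"
      by (rule ending_minus_arrival_split)
    have ne: "u \<noteq> []" "v \<noteq> []" using uv by (auto simp: ending_def return_def arrival_def)
    have "z ^ length u = 1" using 1 uv ne by auto
    moreover have "z ^ length v = 1" using uv by (intro ret[OF total_pos]) auto
    ultimately show ?thesis by (simp add: uv power_add)
  qed
qed

text \<open>
  Primitivity with exponent \<open>k\<close> gives closed walks at \<open>\<theta>\<close> of the coprime lengths \<open>k\<close> and \<open>k + 1\<close>; the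
  second one takes an arbitrary legal first step and then a walk of length \<open>k\<close>.
\<close>

lemma return_aperiodic:
  fixes z :: complex
  assumes ret: "\<And>n. 0 < total return n \<Longrightarrow> z ^ n = 1"
  shows "z = 1"
proof -
  obtain k where k: "0 < k"
    "\<And>i j. \<exists>w. length w = k \<and> successively R (i # w) \<and> last (i # w) = j"
    using primitive by blast
  have closed: "z ^ length w = 1"
    if "successively R (\<theta> # w)" "last (\<theta> # w) = \<theta>" "w \<noteq> []" for w
  proof (rule pow_eq_1_on_closed)
    show "w \<in> ending" "R \<theta> (hd w)" using that by (auto simp: ending_def successively_Cons)
  qed (rule ret)
  obtain w where w: "length w = k" "successively R (\<theta> # w)" "last (\<theta> # w) = \<theta>"
    using k(2) by blast
  have "w \<noteq> []" using w k(1) by auto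
  obtain w' where w': "length w' = k" "successively R (hd w # w')" "last (hd w # w') = \<theta>"
    using k(2) by blast
  have "z ^ k = 1" using closed[of w] w \<open>w \<noteq> []\<close> by simp
  moreover have "z ^ Suc k = 1"
    using closed[of "hd w # w'"] w w' \<open>w \<noteq> []\<close> by (simp add: successively_Cons)
  ultimately show ?thesis by simp
qed

lemma ex_return: "\<exists>n. 0 < total return n"
proof (rule ccontr)
  assume "\<not> ?thesis"
  then have "(2::complex) = 1" using return_aperiodic[of 2] by blast
  then show False by simp
qed

text \<open>
  The least root \<open>\<rho>\<close>, the nonvanishing of the constants and the asymptotics, stated together because all
  of them come from the same choice of \<open>\<rho>\<close>.
\<close>

theorem ending_asymptotics:
  obtains \<rho> where "0 < \<rho>" "ereal \<rho> < fps_conv_radius (gf return)" "eval_fps (gf return) \<rho> = 1"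
    "\<And>t. 0 < t \<Longrightarrow> ereal t < fps_conv_radius (gf return) \<Longrightarrow> eval_fps (gf return) t = 1 \<Longrightarrow> \<rho> \<le> t"
    "0 < eval_fps (gf arrival) \<rho>" "0 < eval_fps (fps_deriv (gf return)) \<rho>"
    "(\<lambda>m. total ending m * \<rho> ^ m) \<longlonglongrightarrow>
       eval_fps (gf arrival) \<rho> / (\<rho> * eval_fps (fps_deriv (gf return)) \<rho>)"
proof -
  let ?A = "gf arrival" and ?B = "gf return"
  have B_nonneg: "0 \<le> fps_nth ?B n" for n by (simp add: total_nonneg)
  have B0: "fps_nth ?B 0 = 0"
    using total_return_le_arrival[of 0] total_arrival_0 total_nonneg[of return 0] by simp
  obtain n where n: "0 < fps_nth ?B n" using ex_return by auto
  have n0: "0 < n" using n B0 by (cases n) auto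
  have inside: "ereal t < fps_conv_radius ?A" if "0 < t" "summable (\<lambda>k. fps_nth ?B k * t ^ k)" for t
    using radius_arrival_gt_of_return_tends_to_0[OF that(1)] summable_LIMSEQ_zero[OF that(2)] by simp
  have "\<exists>t>0. ereal t < fps_conv_radius ?B \<and> eval_fps ?B t = 1"
  proof (rule eval_fps_eq_1_root[OF B_nonneg B0 n])
    show "0 < fps_conv_radius ?B"
      using radius_arrival_pos radius_return_ge_arrival by (rule less_le_trans)
    show "\<not> summable (\<lambda>k. fps_nth ?B k * r ^ k)" if "0 < r" "fps_conv_radius ?B = ereal r" for r
      using inside[OF that(1)] that(2) radius_return_ge_arrival by (auto simp: not_less[symmetric])
  qed
  then obtain \<rho> where \<rho>: "0 < \<rho>" "ereal \<rho> < fps_conv_radius ?B" "eval_fps ?B \<rho> = 1" by blast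
  have rA: "ereal \<rho> < fps_conv_radius ?A"
    using \<rho> sums_eval_fps[of \<rho> ?B] by (intro inside) (auto simp: sums_iff)
  have aper: "z = 1" if "\<And>n. 0 < fps_nth ?B n \<Longrightarrow> z ^ n = 1" for z :: complex
    by (rule return_aperiodic, rule that) simp
  note R = renewal_theorem[OF B_nonneg B0 \<rho>(1) rA \<rho>(2,3) aper gf_renewal]
  show thesis
  proof (rule that[OF \<rho>])
    show "\<rho> \<le> t" if "0 < t" "ereal t < fps_conv_radius ?B" "eval_fps ?B t = 1" for t
    proof (rule ccontr)
      assume "\<not> \<rho> \<le> t"
      then have "eval_fps ?B t < eval_fps ?B \<rho>"
        using that \<rho> n n0 by (intro eval_fps_strict_mono[OF B_nonneg]) auto
      then show False using that \<rho> by simp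
    qed
    have "[\<theta>] \<in> arrival" by (simp add: arrival_def ending_def)
    then have "0 < total arrival 1 * \<rho> ^ 1" using \<rho> by (simp add: total_pos)
    also have "\<dots> \<le> eval_fps ?A \<rho>"
      using eval_fps_ge_term[of ?A \<rho> 1] rA \<rho> by (simp add: total_nonneg)
    finally show "0 < eval_fps ?A \<rho>" .
    show "0 < eval_fps (fps_deriv ?B) \<rho>" by (rule R(2))
    show "(\<lambda>m. total ending m * \<rho> ^ m) \<longlonglongrightarrow> eval_fps ?A \<rho> / (\<rho> * eval_fps (fps_deriv ?B) \<rho>)"
      using R(1) by simp
  qed
qed

end

section \<open>Walks in the plane\<close>

text \<open>
  A positive entry of a power has a positive term in the matrix product that defines it; its two factors
  give the first step and, by induction, the rest of the walk.
\<close>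

lemma walk_of_matrix_power_pos:
  assumes "matrix_power (transfer_matrix R) k $ i $ j > 0"
  shows "\<exists>w. length w = k \<and> successively R (i # w) \<and> last (i # w) = j"
  using assms
proof (induction k arbitrary: i)
  case 0
  then show ?case by (auto simp: matrix_power_def mat_def split: if_splits)
next
  case (Suc k)
  let ?T = "transfer_matrix R"
  have "matrix_power ?T (Suc k) $ i $ j = (\<Sum>s\<in>UNIV. ?T $ i $ s * matrix_power ?T k $ s $ j)"
    by (simp add: matrix_power_def matrix_matrix_mult_def)
  then obtain s where s: "0 < ?T $ i $ s * matrix_power ?T k $ s $ j"
    using Suc.prems by (metis (no_types, lifting) leD not_less sum_nonpos)
  then have "R i s" "0 < matrix_power ?T k $ s $ j"
    by (cases "R i s"; simp add: transfer_matrix_def)+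
  with Suc.IH obtain w where "length w = k" "successively R (s # w)" "last (s # w) = j"
    by blast
  with \<open>R i s\<close> show ?case
    by (intro exI[of _ "s # w"]) auto
qed

definition step_weight :: "real \<Rightarrow> real \<Rightarrow> step \<Rightarrow> real" where
  "step_weight x y s = x powi fst (step_vec s) * y powi snd (step_vec s)"

lemma weight_step_weight:
  assumes "x \<noteq> 0" "y \<noteq> 0"
  shows "weight (step_weight x y) w = x powi fst (endpoint w) * y powi snd (endpoint w)"
proof (induction w)
  case Nil
  then show ?case by (simp add: endpoint_def zero_prod_def)
next
  case (Cons s w)
  have "endpoint (s # w) = step_vec s + endpoint w" by (simp add: endpoint_def)
  then show ?case
    using assms Cons by (simp add: step_weight_def power_int_add)
qed

theorem corollary1:
  fixes R :: two_step_rule and \<theta> :: step and x y :: real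
  assumes "aperiodic_rule R" and "x > 0" and "y > 0"
  shows "(\<lambda>m. Theta_coeff R \<theta> m x y) \<sim>[at_top]
         (\<lambda>m. mu R \<theta> x y
              * (A_fun R \<theta> (rho R \<theta> x y) x y / deriv (\<lambda>t. B_fun R \<theta> t x y) (rho R \<theta> x y))
              * mu R \<theta> x y ^ m)"
proof -
  interpret primitive_weighted_rule R "step_weight x y" \<theta>
  proof
    show "0 < step_weight x y s" for s
      using assms by (simp add: step_weight_def)
    obtain k where "k \<ge> 1" "\<forall>i j. matrix_power (transfer_matrix R) k $ i $ j > 0"
      using assms(1) by (auto simp: aperiodic_rule_def)
    then have "0 < k \<and> (\<forall>i j. \<exists>w. length w = k \<and> successively R (i # w) \<and> last (i # w) = j)"
      using walk_of_matrix_power_pos by auto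
    then show "\<exists>k>0. \<forall>i j. \<exists>w. length w = k \<and> successively R (i # w) \<and> last (i # w) = j"
      by blast
  qed
  have walk_gf_eq: "walk_gf C x y = gf C" for C
    using assms by (simp add: fps_eq_iff walk_gf_def total_def level_def weight_step_weight)
  have F: "F_gf R \<theta> x y = gf ending"
    unfolding F_gf_def walk_gf_eq by (rule arg_cong[of _ _ gf]) (auto simp: ending_def walk_def)
  have A: "A_gf R \<theta> x y = gf arrival"
    unfolding A_gf_def walk_gf_eq
    by (rule arg_cong[of _ _ gf]) (auto simp: arrival_def ending_def walk_def)
  have B: "B_gf R \<theta> x y = gf return"
    unfolding B_gf_def walk_gf_eq
    by (rule arg_cong[of _ _ gf]) (auto simp: return_def arrival_def ending_def walk_def)

  obtain \<rho> where \<rho>: "0 < \<rho>" "ereal \<rho> < fps_conv_radius (gf return)" "eval_fps (gf return) \<rho> = 1"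
    and least: "\<And>t. 0 < t \<Longrightarrow> ereal t < fps_conv_radius (gf return) \<Longrightarrow>
        eval_fps (gf return) t = 1 \<Longrightarrow> \<rho> \<le> t"
    and A_pos: "0 < eval_fps (gf arrival) \<rho>"
    and B'_pos: "0 < eval_fps (fps_deriv (gf return)) \<rho>"
    and lim: "(\<lambda>m. total ending m * \<rho> ^ m) \<longlonglongrightarrow>
        eval_fps (gf arrival) \<rho> / (\<rho> * eval_fps (fps_deriv (gf return)) \<rho>)"
    using ending_asymptotics by blast
  define c where "c = eval_fps (gf arrival) \<rho> / (\<rho> * eval_fps (fps_deriv (gf return)) \<rho>)"
  have c: "c \<noteq> 0" using A_pos B'_pos \<rho> by (simp add: c_def)
  have rho: "rho R \<theta> x y = \<rho>"
    unfolding rho_def B_fun_def B using \<rho> least by (intro Least_equality) auto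
  have deriv: "deriv (\<lambda>t. B_fun R \<theta> t x y) \<rho> = eval_fps (fps_deriv (gf return)) \<rho>"
    unfolding B_fun_def B using \<rho> by (subst eval_fps_deriv) auto
  have rhs: "mu R \<theta> x y
      * (A_fun R \<theta> (rho R \<theta> x y) x y / deriv (\<lambda>t. B_fun R \<theta> t x y) (rho R \<theta> x y))
      * mu R \<theta> x y ^ m = c / \<rho> ^ m" for m
    by (simp add: rho deriv mu_def A_fun_def A c_def power_inverse divide_inverse)
  have "(\<lambda>m. total ending m * \<rho> ^ m / c) \<longlonglongrightarrow> c / c"
    using lim c unfolding c_def[symmetric] by (intro tendsto_divide tendsto_const) auto
  then have "(\<lambda>m. total ending m / (c / \<rho> ^ m)) \<longlonglongrightarrow> 1"
    using c \<rho> by simp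
  then have "(\<lambda>m. total ending m) \<sim>[at_top] (\<lambda>m. c / \<rho> ^ m)"
    by (rule asymp_equivI')
  then show ?thesis
    by (simp only: rhs) (simp add: Theta_coeff_def F)
qed

end
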